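(* A locally convex space $E$ is topologically isomorphic to $\varphi=L(\omega)$ if and only if $E$ is an infinite-dimensional $k_{\mathbb R}$-space containing no infinite-dimensional compact subset.
   Context: $\varphi=L(\omega)$ is a vector space of countably infinite Hamel dimension endowed with the finest locally convex topology. A topological space $X$ is a $k_{\mathbb R}$-space if a function $f:X\to\mathbb R$ is continuous whenever its restriction $f\restriction K$ is continuous for every compact $K\subseteq X$. A compact subset is infinite-dimensional if it has infinite topological dimension (equivalently, here, it is not contained in a finite-dimensional subspace). *)

theory Defs
  imports "HOL-Analysis.Analysis"
begin

definition locally_convex_space :: "'a::real_vector topology \<Rightarrow> bool" where
  "locally_convex_space T \<longleftrightarrow>
     topspace T = UNIV \<and>
     Hausdorff_space T \<and>
     continuous_map (prod_topology T T) T (\<lambda>(x, y). x + y) \<and>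
     continuous_map (prod_topology euclideanreal T) T (\<lambda>(c, x). c *\<^sub>R x) \<and>
     (\<forall>U. openin T U \<and> 0 \<in> U \<longrightarrow> (\<exists>V. openin T V \<and> 0 \<in> V \<and> convex V \<and> V \<subseteq> U))"

text \<open>Concrete model of phi = L(omega): finitely supported real sequences
  (a vector space of countably infinite Hamel dimension), operations pointwise.\<close>
definition phi_set :: "(nat \<Rightarrow> real) set" where
  "phi_set = {x. finite {n. x n \<noteq> 0}}"

definition phi_abs_convex :: "(nat \<Rightarrow> real) set \<Rightarrow> bool" where
  "phi_abs_convex A \<longleftrightarrow> A \<subseteq> phi_set \<and>
     (\<forall>x\<in>A. \<forall>y\<in>A. \<forall>a b::real. \<bar>a\<bar> + \<bar>b\<bar> \<le> 1 \<longrightarrow> (\<lambda>n. a * x n + b * y n) \<in> A)"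

definition phi_absorbing :: "(nat \<Rightarrow> real) set \<Rightarrow> bool" where
  "phi_absorbing A \<longleftrightarrow>
     (\<forall>x\<in>phi_set. \<exists>t>0. \<forall>s::real. \<bar>s\<bar> \<le> t \<longrightarrow> (\<lambda>n. s * x n) \<in> A)"

text \<open>The finest locally convex topology on phi: its 0-neighbourhood base consists
  of all absolutely convex absorbing sets.\<close>
definition phi_topology :: "(nat \<Rightarrow> real) topology" where
  "phi_topology = topology (\<lambda>U. U \<subseteq> phi_set \<and>
     (\<forall>x\<in>U. \<exists>A. phi_abs_convex A \<and> phi_absorbing A \<and> (\<forall>a\<in>A. (\<lambda>n. x n + a n) \<in> U)))"

definition top_iso_phi :: "'a::real_vector topology \<Rightarrow> bool" where
  "top_iso_phi T \<longleftrightarrow> (\<exists>f :: 'a \<Rightarrow> nat \<Rightarrow> real.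
     (\<forall>x y. f (x + y) = (\<lambda>n. f x n + f y n)) \<and>
     (\<forall>c x. f (c *\<^sub>R x) = (\<lambda>n. c * f x n)) \<and>
     bij_betw f UNIV phi_set \<and>
     homeomorphic_map T phi_topology f)"

definition finite_dimensional_set :: "'a::real_vector set \<Rightarrow> bool" where
  "finite_dimensional_set S \<longleftrightarrow> (\<exists>B. finite B \<and> S \<subseteq> span B)"

definition k_R_space :: "'a topology \<Rightarrow> bool" where
  "k_R_space X \<longleftrightarrow> (\<forall>f :: 'a \<Rightarrow> real.
     (\<forall>K. compactin X K \<longrightarrow> continuous_map (subtopology X K) euclideanreal f)
       \<longrightarrow> continuous_map X euclideanreal f)"

end

theory Submission
  imports Defs
begin

text \<open>In \<open>\<phi>\<close> the weighted \<open>l\<^sup>1\<close> balls, for arbitrary positive weights, form a base at 0. Choosing weights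
  adapted to a set shows that compact sets are finite-dimensional, and choosing them by repeated use
  of the tube lemma along the increasing finite-dimensional subspaces shows that \<open>\<phi>\<close> is a
  \<open>k\<^sub>R\<close>-space.

  Conversely, let every compact subset of the \<open>k\<^sub>R\<close>-space \<open>E\<close> be finite-dimensional and let \<open>B\<close> be a
  Hamel basis. Coordinates are continuous on finite-dimensional subspaces, so every function
  \<open>x \<mapsto> \<Sum>\<^sub>b h\<^sub>b(x\<^sub>b)\<close> with \<open>h\<^sub>b\<close> continuous and \<open>h\<^sub>b(0) = 0\<close> is continuous on \<open>E\<close>. For
  \<open>h\<^sub>b(t) = sqrt \<bar>t\<bar>\<close> local convexity then forces \<open>B\<close> to be countable, and for \<open>h\<^sub>b(t) = w\<^sub>b \<bar>t\<bar>\<close>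
  it follows that \<open>E\<close> carries the finest locally convex topology.\<close>

section \<open>Finite sums over supports and weighted l1 norms\<close>

text \<open>Index type and summand are general so that one notion serves sequences and Hamel
  coordinates, with both \<open>sqrt \<bar>t\<bar>\<close> and \<open>w i * \<bar>t\<bar>\<close> as
  summand. An infinite support gives 0.\<close>

definition finsum_on_support :: "('i \<Rightarrow> real \<Rightarrow> real) \<Rightarrow> ('i \<Rightarrow> real) \<Rightarrow> real" where
  "finsum_on_support h x = (\<Sum>i | x i \<noteq> 0. h i (x i))"

lemma finsum_on_support_superset:
  assumes "finite N" "{i. x i \<noteq> 0} \<subseteq> N" "\<And>i. h i 0 = 0"
  shows "finsum_on_support h x = (\<Sum>i\<in>N. h i (x i))"
  unfolding finsum_on_support_def
  by (rule sum.mono_neutral_left) (use assms in auto)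

abbreviation weighted_l1 :: "('i \<Rightarrow> real) \<Rightarrow> ('i \<Rightarrow> real) \<Rightarrow> real" where
  "weighted_l1 w \<equiv> finsum_on_support (\<lambda>i t. w i * \<bar>t\<bar>)"

lemma weighted_l1_superset:
  assumes "finite N" "{i. x i \<noteq> 0} \<subseteq> N"
  shows "weighted_l1 w x = (\<Sum>i\<in>N. w i * \<bar>x i\<bar>)"
  using assms by (rule finsum_on_support_superset) simp

lemma phi_set_iff: "x \<in> phi_set \<longleftrightarrow> finite {n. x n \<noteq> 0}"
  by (simp add: phi_set_def)

lemma phi_set_lincomb:
  assumes "x \<in> phi_set" "y \<in> phi_set"
  shows "(\<lambda>n. a * x n + b * y n) \<in> phi_set"
proof -
  have "{n. a * x n + b * y n \<noteq> 0} \<subseteq> {n. x n \<noteq> 0} \<union> {n. y n \<noteq> 0}"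
    by auto
  then show ?thesis
    using assms unfolding phi_set_iff by (meson finite_UnI finite_subset)
qed

lemma phi_set_add: "x \<in> phi_set \<Longrightarrow> y \<in> phi_set \<Longrightarrow> (\<lambda>n. x n + y n) \<in> phi_set"
  using phi_set_lincomb[of x y 1 1] by simp

lemma phi_set_scale: "x \<in> phi_set \<Longrightarrow> (\<lambda>n. a * x n) \<in> phi_set"
  using phi_set_lincomb[of x x a 0] by simp

lemma weighted_l1_nonneg:
  assumes "\<And>n. 0 \<le> w n"
  shows "0 \<le> weighted_l1 w x"
  unfolding finsum_on_support_def by (intro sum_nonneg mult_nonneg_nonneg assms) auto

lemma weighted_l1_ge_term:
  assumes "finite {i. x i \<noteq> 0}" "\<And>n. 0 \<le> w n"
  shows "w n * \<bar>x n\<bar> \<le> weighted_l1 w x"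
proof -
  have "w n * \<bar>x n\<bar> \<le> (\<Sum>i\<in>insert n {i. x i \<noteq> 0}. w i * \<bar>x i\<bar>)"
    by (rule member_le_sum) (use assms in auto)
  then show ?thesis
    using assms(1) by (subst weighted_l1_superset[of "insert n {i. x i \<noteq> 0}"]) auto
qed

lemma weighted_l1_lincomb:
  assumes "x \<in> phi_set" "y \<in> phi_set" "\<And>n. 0 \<le> w n"
  shows "weighted_l1 w (\<lambda>n. a * x n + b * y n) \<le> \<bar>a\<bar> * weighted_l1 w x + \<bar>b\<bar> * weighted_l1 w y"
proof -
  \<comment> \<open>All three supports lie in this union, so the three norms become sums over one
    finite set.\<close>
  let ?N = "{n. x n \<noteq> 0} \<union> {n. y n \<noteq> 0}"
  have N: "finite ?N" using assms by (simp add: phi_set_iff)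
  have "weighted_l1 w (\<lambda>n. a * x n + b * y n) = (\<Sum>n\<in>?N. w n * \<bar>a * x n + b * y n\<bar>)"
    by (rule weighted_l1_superset[OF N]) auto
  also have "\<dots> \<le> (\<Sum>n\<in>?N. \<bar>a\<bar> * (w n * \<bar>x n\<bar>) + \<bar>b\<bar> * (w n * \<bar>y n\<bar>))"
  proof (rule sum_mono)
    fix n
    have "\<bar>a * x n + b * y n\<bar> \<le> \<bar>a\<bar> * \<bar>x n\<bar> + \<bar>b\<bar> * \<bar>y n\<bar>"
      by (metis abs_mult abs_triangle_ineq)
    then have "w n * \<bar>a * x n + b * y n\<bar> \<le> w n * (\<bar>a\<bar> * \<bar>x n\<bar> + \<bar>b\<bar> * \<bar>y n\<bar>)"
      by (rule mult_left_mono) (rule assms)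
    then show "w n * \<bar>a * x n + b * y n\<bar> \<le> \<bar>a\<bar> * (w n * \<bar>x n\<bar>) + \<bar>b\<bar> * (w n * \<bar>y n\<bar>)"
      by (simp add: algebra_simps)
  qed
  also have "\<dots> = \<bar>a\<bar> * (\<Sum>n\<in>?N. w n * \<bar>x n\<bar>) + \<bar>b\<bar> * (\<Sum>n\<in>?N. w n * \<bar>y n\<bar>)"
    by (simp add: sum.distrib sum_distrib_left)
  also have "\<dots> = \<bar>a\<bar> * weighted_l1 w x + \<bar>b\<bar> * weighted_l1 w y"
    using weighted_l1_superset[OF N, of x w] weighted_l1_superset[OF N, of y w] by auto
  finally show ?thesis .
qed

lemma weighted_l1_scale:
  assumes "x \<in> phi_set" "\<And>n. 0 \<le> w n"
  shows "weighted_l1 w (\<lambda>n. a * x n) \<le> \<bar>a\<bar> * weighted_l1 w x"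
  using weighted_l1_lincomb[of x x w a 0] assms by simp

section \<open>The topology of \<open>phi_topology\<close> and the weighted balls\<close>

lemma phi_abs_convex_Int: "phi_abs_convex A \<Longrightarrow> phi_abs_convex B \<Longrightarrow> phi_abs_convex (A \<inter> B)"
  unfolding phi_abs_convex_def by auto

lemma phi_absorbing_Int:
  assumes "phi_absorbing A" "phi_absorbing B"
  shows "phi_absorbing (A \<inter> B)"
  unfolding phi_absorbing_def
proof
  fix x assume x: "x \<in> phi_set"
  obtain s where s: "s > 0" "\<And>r. \<bar>r\<bar> \<le> s \<Longrightarrow> (\<lambda>n. r * x n) \<in> A"
    using assms(1) x unfolding phi_absorbing_def by blast
  obtain t where t: "t > 0" "\<And>r. \<bar>r\<bar> \<le> t \<Longrightarrow> (\<lambda>n. r * x n) \<in> B"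
    using assms(2) x unfolding phi_absorbing_def by blast
  show "\<exists>t>0. \<forall>s. \<bar>s\<bar> \<le> t \<longrightarrow> (\<lambda>n. s * x n) \<in> A \<inter> B"
    using s t by (intro exI[of _ "min s t"]) auto
qed

text \<open>\<open>topology\<close> has the intended open sets only for an \<open>istopology\<close>
  predicate. For binary intersections, the neighbourhoods \<open>A\<close> and \<open>B\<close> of 0
  are replaced by \<open>A \<inter> B\<close>.\<close>

lemma openin_phi_topology:
  "openin phi_topology U \<longleftrightarrow> U \<subseteq> phi_set \<and>
     (\<forall>x\<in>U. \<exists>A. phi_abs_convex A \<and> phi_absorbing A \<and> (\<forall>a\<in>A. (\<lambda>n. x n + a n) \<in> U))"
proof -
  let ?P = "\<lambda>U. U \<subseteq> phi_set \<and>
     (\<forall>x\<in>U. \<exists>A. phi_abs_convex A \<and> phi_absorbing A \<and> (\<forall>a\<in>A. (\<lambda>n. x n + a n) \<in> U))"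
  have "?P (U \<inter> V)" if U: "?P U" and V: "?P V" for U V
  proof (intro conjI ballI)
    fix x assume x: "x \<in> U \<inter> V"
    obtain A where A: "phi_abs_convex A" "phi_absorbing A" "\<forall>a\<in>A. (\<lambda>n. x n + a n) \<in> U"
      using U x by blast
    obtain B where B: "phi_abs_convex B" "phi_absorbing B" "\<forall>a\<in>B. (\<lambda>n. x n + a n) \<in> V"
      using V x by blast
    show "\<exists>A. phi_abs_convex A \<and> phi_absorbing A \<and> (\<forall>a\<in>A. (\<lambda>n. x n + a n) \<in> U \<inter> V)"
      using A B phi_abs_convex_Int phi_absorbing_Int by (intro exI[of _ "A \<inter> B"]) auto
  qed (use U in blast)
  moreover have "?P (\<Union>\<K>)" if \<K>: "\<forall>K\<in>\<K>. ?P K" for \<K>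
  proof (intro conjI ballI)
    fix x assume "x \<in> \<Union>\<K>"
    then obtain K where K: "K \<in> \<K>" "x \<in> K" by blast
    then obtain A where "phi_abs_convex A" "phi_absorbing A" "\<forall>a\<in>A. (\<lambda>n. x n + a n) \<in> K"
      using \<K> by blast
    then show "\<exists>A. phi_abs_convex A \<and> phi_absorbing A \<and> (\<forall>a\<in>A. (\<lambda>n. x n + a n) \<in> \<Union>\<K>)"
      using K by blast
  qed (use \<K> in blast)
  ultimately have "istopology ?P"
    unfolding istopology_def by blast
  then show ?thesis
    unfolding phi_topology_def by simp
qed

lemma topspace_phi_topology: "topspace phi_topology = phi_set"
proof
  show "topspace phi_topology \<subseteq> phi_set"
    using openin_phi_topology openin_topspace by blast
  have "phi_abs_convex phi_set"
    by (simp add: phi_abs_convex_def phi_set_lincomb)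
  moreover have "phi_absorbing phi_set"
    unfolding phi_absorbing_def using phi_set_scale by (meson zero_less_one)
  ultimately have "openin phi_topology phi_set"
    unfolding openin_phi_topology using phi_set_add by blast
  then show "phi_set \<subseteq> topspace phi_topology"
    by (rule openin_subset)
qed

text \<open>Around a point \<open>x\<close> of the unit ball the triangle inequality leaves room for
  the ball of radius \<open>1 - weighted_l1 w x\<close>, which is absolutely convex and
  absorbing.\<close>

lemma openin_phi_weighted_l1_ball:
  assumes w: "\<And>n. 0 < w n"
  shows "openin phi_topology {x\<in>phi_set. weighted_l1 w x < 1}"
  unfolding openin_phi_topology
proof (intro conjI ballI)
  note w0 = less_imp_le[OF w]
  fix x assume "x \<in> {x\<in>phi_set. weighted_l1 w x < 1}"
  then have x: "x \<in> phi_set" "weighted_l1 w x < 1" by auto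
  define r where "r = 1 - weighted_l1 w x"
  have r: "r > 0" using x by (simp add: r_def)
  define A where "A = {a\<in>phi_set. weighted_l1 w a < r}"
  have "phi_abs_convex A"
    unfolding phi_abs_convex_def
  proof (intro conjI ballI allI impI)
    fix y z and a b :: real
    assume yz: "y \<in> A" "z \<in> A" and ab: "\<bar>a\<bar> + \<bar>b\<bar> \<le> 1"
    \<comment> \<open>Passing to the maximum keeps the final inequality strict also when
      \<open>a\<close> and \<open>b\<close> are both 0.\<close>
    let ?m = "max (weighted_l1 w y) (weighted_l1 w z)"
    have m: "0 \<le> ?m" "?m < r"
      using yz weighted_l1_nonneg[of w y] w0 by (auto simp: A_def)
    have "weighted_l1 w (\<lambda>n. a * y n + b * z n) \<le> \<bar>a\<bar> * weighted_l1 w y + \<bar>b\<bar> * weighted_l1 w z"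
      using yz w0 by (intro weighted_l1_lincomb) (auto simp: A_def)
    also have "\<dots> \<le> \<bar>a\<bar> * ?m + \<bar>b\<bar> * ?m"
      by (intro add_mono mult_left_mono) auto
    also have "\<dots> = (\<bar>a\<bar> + \<bar>b\<bar>) * ?m" by (simp add: algebra_simps)
    also have "\<dots> \<le> 1 * ?m" using ab m by (intro mult_right_mono) auto
    finally show "(\<lambda>n. a * y n + b * z n) \<in> A"
      using m yz phi_set_lincomb by (auto simp: A_def)
  qed (auto simp: A_def)
  moreover have "phi_absorbing A"
    unfolding phi_absorbing_def
  proof
    fix y assume y: "y \<in> phi_set"
    let ?p = "weighted_l1 w y"
    have p: "?p \<ge> 0" using w0 by (rule weighted_l1_nonneg)
    \<comment> \<open>The summand 1 keeps the denominator positive if \<open>?p = 0\<close> and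
      makes \<open>r / (?p + 1) * ?p\<close> strictly smaller than \<open>r\<close>.\<close>
    have "(\<lambda>n. s * y n) \<in> A" if s: "\<bar>s\<bar> \<le> r / (?p + 1)" for s
    proof -
      have "weighted_l1 w (\<lambda>n. s * y n) \<le> \<bar>s\<bar> * ?p"
        using y w0 by (rule weighted_l1_scale)
      also have "\<dots> \<le> r / (?p + 1) * ?p"
        using s p by (rule mult_right_mono)
      also have "\<dots> < r"
        using p r by (simp add: field_simps)
      finally show ?thesis
        using y phi_set_scale by (simp add: A_def)
    qed
    then show "\<exists>t>0. \<forall>s. \<bar>s\<bar> \<le> t \<longrightarrow> (\<lambda>n. s * y n) \<in> A"
      using p r by (intro exI[of _ "r / (?p + 1)"]) auto
  qed
  moreover have "(\<lambda>n. x n + a n) \<in> {x\<in>phi_set. weighted_l1 w x < 1}" if "a \<in> A" for a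
    using weighted_l1_lincomb[of x a w 1 1] that x w0 phi_set_add[of x a]
    by (auto simp: A_def r_def)
  ultimately show "\<exists>A. phi_abs_convex A \<and> phi_absorbing A \<and>
      (\<forall>a\<in>A. (\<lambda>n. x n + a n) \<in> {x\<in>phi_set. weighted_l1 w x < 1})"
    by blast
qed auto

text \<open>Induction on \<open>N\<close>: the combination over the old indices is \<open>s\<close>
  times one with coefficients \<open>c i / s\<close>, which leaves a combination of two
  points.\<close>

lemma phi_abs_convex_sum:
  assumes A: "phi_abs_convex A" "(\<lambda>n. 0) \<in> A"
    and "finite N" "\<And>i. i \<in> N \<Longrightarrow> u i \<in> A" "(\<Sum>i\<in>N. \<bar>c i\<bar>) \<le> 1"
  shows "(\<lambda>n. \<Sum>i\<in>N. c i * u i n) \<in> A"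
  using assms(3-5)
proof (induction N arbitrary: c rule: finite_induct)
  case empty
  then show ?case using A by simp
next
  case (insert k N)
  define s where "s = (\<Sum>i\<in>N. \<bar>c i\<bar>)"
  have s0: "s \<ge> 0" by (simp add: s_def sum_nonneg)
  have s1: "s + \<bar>c k\<bar> \<le> 1" using insert by (simp add: s_def)
  have "(\<Sum>i\<in>N. \<bar>c i / s\<bar>) = (\<Sum>i\<in>N. \<bar>c i\<bar>) / s"
    using s0 by (simp add: sum_divide_distrib)
  also have "\<dots> = s / s" by (simp add: s_def)
  also have "\<dots> \<le> 1" by simp
  finally have IH: "(\<lambda>n. \<Sum>i\<in>N. c i / s * u i n) \<in> A"
    using insert by (intro insert.IH) auto
  \<comment> \<open>If \<open>s = 0\<close>, both sides are 0, the right one because every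
    \<open>c i\<close> with \<open>i \<in> N\<close> vanishes.\<close>
  have eq: "s * (\<Sum>i\<in>N. c i / s * u i n) = (\<Sum>i\<in>N. c i * u i n)" for n
  proof (cases "s = 0")
    case True
    then have "\<forall>i\<in>N. c i = 0"
      using insert.hyps by (simp add: s_def sum_nonneg_eq_0_iff)
    then show ?thesis using True by simp
  qed (simp add: sum_distrib_left)
  have "(\<lambda>n. s * (\<Sum>i\<in>N. c i / s * u i n) + c k * u k n) \<in> A"
    using A(1) IH insert.prems(1)[of k] s0 s1 unfolding phi_abs_convex_def by auto
  then show ?case
    unfolding eq using insert.hyps by (simp add: add.commute)
qed

lemma phi_absorbing_zero:
  assumes "phi_absorbing A"
  shows "(\<lambda>n. 0) \<in> A"
proof -
  have "(\<lambda>n. 0) \<in> phi_set" by (simp add: phi_set_iff)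
  then obtain t where "t > 0" "\<forall>s::real. \<bar>s\<bar> \<le> t \<longrightarrow> (\<lambda>n. s * 0) \<in> A"
    using assms unfolding phi_absorbing_def by fastforce
  then show ?thesis
    by (metis abs_zero less_imp_le mult_zero_right)
qed

text \<open>Absorption puts a positive multiple, by \<open>t i\<close>, of each unit vector into
  \<open>A\<close>. With weights \<open>1 / t i\<close>, a vector of norm below 1 is an absolutely
  convex combination of these multiples.\<close>

lemma weighted_l1_ball_subset_phi_nbhd:
  assumes A: "phi_abs_convex A" "phi_absorbing A"
  obtains w where "{x\<in>phi_set. weighted_l1 w x < 1} \<subseteq> A"
proof -
  define e where "e = (\<lambda>i n::nat. if n = i then 1 else 0 :: real)"
  have "e i \<in> phi_set" for i by (simp add: e_def phi_set_iff)
  then have "\<exists>t>0. (\<lambda>n. t * e i n) \<in> A" for i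
    using A(2) unfolding phi_absorbing_def by (metis abs_of_pos order_refl)
  then obtain t where t: "\<And>i. t i > 0" "\<And>i. (\<lambda>n. t i * e i n) \<in> A"
    by metis
  define w where "w n = 1 / t n" for n
  have "x \<in> A" if x: "x \<in> phi_set" "weighted_l1 w x < 1" for x
  proof -
    let ?N = "{n. x n \<noteq> 0}"
    have N: "finite ?N" using x by (simp add: phi_set_iff)
    have "(\<lambda>n. \<Sum>i\<in>?N. (x i / t i) * (t i * e i n)) \<in> A"
    proof (rule phi_abs_convex_sum[OF A(1) phi_absorbing_zero[OF A(2)] N])
      show "(\<Sum>i\<in>?N. \<bar>x i / t i\<bar>) \<le> 1"
        using x t(1) by (simp add: w_def finsum_on_support_def less_imp_le abs_of_pos)
    qed (rule t)
    moreover have "(\<Sum>i\<in>?N. (x i / t i) * (t i * e i n)) = x n" for n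
    proof -
      have "(\<Sum>i\<in>?N. (x i / t i) * (t i * e i n)) = (\<Sum>i\<in>?N. if i = n then x i else 0)"
        using t(1) by (intro sum.cong) (auto simp: e_def less_imp_neq[symmetric])
      also have "\<dots> = x n" using N by simp
      finally show ?thesis .
    qed
    ultimately show ?thesis by simp
  qed
  then show thesis using that by blast
qed

section \<open>Coordinates on finite-dimensional subspaces of a locally convex space\<close>

text \<open>On \<open>span F\<close> the coordinates relative to \<open>B\<close> agree with those
  relative to \<open>F\<close>.\<close>

lemma representation_eq_0_outside:
  assumes "independent B" "F \<subseteq> B" "x \<in> span F" "b \<notin> F"
  shows "representation B x b = 0"
  using representation_extend[OF assms(1,3,2)] representation_ne_zero assms(4) by metis

context
  fixes T :: "'a::real_vector topology"
  assumes lcs: "locally_convex_space T"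
begin

lemma lcs_topspace [simp]: "topspace T = UNIV"
  using lcs by (simp add: locally_convex_space_def)

lemma lcs_continuous_add:
  assumes "continuous_map X T f" "continuous_map X T g"
  shows "continuous_map X T (\<lambda>x. f x + g x)"
proof -
  have "continuous_map (prod_topology T T) T (\<lambda>(x, y). x + y)"
    using lcs by (simp add: locally_convex_space_def)
  from continuous_map_compose[OF continuous_map_pairedI[OF assms] this]
  show ?thesis by (simp add: o_def)
qed

lemma lcs_continuous_scaleR:
  assumes "continuous_map X euclideanreal f" "continuous_map X T g"
  shows "continuous_map X T (\<lambda>x. f x *\<^sub>R g x)"
proof -
  have "continuous_map (prod_topology euclideanreal T) T (\<lambda>(c, x). c *\<^sub>R x)"
    using lcs by (simp add: locally_convex_space_def)
  from continuous_map_compose[OF continuous_map_pairedI[OF assms] this]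
  show ?thesis by (simp add: o_def)
qed

lemma lcs_continuous_sum:
  assumes "finite I" "\<And>i. i \<in> I \<Longrightarrow> continuous_map X T (f i)"
  shows "continuous_map X T (\<lambda>x. \<Sum>i\<in>I. f i x)"
  using assms by (induction I rule: finite_induct) (simp_all add: lcs_continuous_add)

text \<open>With both \<open>c\<close> and \<open>x\<close> free, this covers the translates,
  reflections and dilates of neighbourhoods of 0 used below.\<close>

lemma lcs_continuous_affine: "continuous_map T T (\<lambda>y. c *\<^sub>R (y - x))"
proof -
  have "continuous_map T T (\<lambda>y. c *\<^sub>R (y + (- x)))"
    by (intro lcs_continuous_scaleR lcs_continuous_add) simp_all
  then show ?thesis by simp
qed

lemma lcs_openin_affine_preimage: "openin T U \<Longrightarrow> openin T {y. c *\<^sub>R (y - x) \<in> U}"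
  using openin_continuous_map_preimage[OF lcs_continuous_affine] by fastforce

lemma lcs_openin_translation: "openin T U \<Longrightarrow> openin T {y. y - x \<in> U}"
  using lcs_openin_affine_preimage[of U 1 x] by simp

lemma lcs_absorbs:
  assumes "openin T U" "0 \<in> U"
  obtains d where "d > 0" "\<And>c. \<bar>c\<bar> < d \<Longrightarrow> c *\<^sub>R x \<in> U"
proof -
  have "continuous_map euclideanreal T (\<lambda>c. c *\<^sub>R x)"
    by (intro lcs_continuous_scaleR) simp_all
  from openin_continuous_map_preimage[OF this assms(1)]
  have "open {c. c *\<^sub>R x \<in> U}" by simp
  moreover have "0 \<in> {c. c *\<^sub>R x \<in> U}" using assms by simp
  ultimately obtain d where "d > 0" "ball 0 d \<subseteq> {c. c *\<^sub>R x \<in> U}"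
    using open_contains_ball by metis
  then show thesis using that[of d] by (auto simp: dist_real_def subset_iff)
qed

lemma lcs_convex_nbhd:
  assumes "openin T U" "0 \<in> U"
  obtains V where "openin T V" "0 \<in> V" "convex V" "V \<subseteq> U"
  using assms lcs unfolding locally_convex_space_def by blast

text \<open>The image of the sphere of the sup norm is compact and misses 0, so by homogeneity the
  coordinates are bounded near 0.\<close>
lemma coordinate_bounded_near_0:
  assumes B: "independent B" and F: "finite F" "F \<subseteq> B"
  obtains V M where "openin T V" "0 \<in> V" "M > 0"
    "\<And>x b. x \<in> V \<Longrightarrow> x \<in> span F \<Longrightarrow> b \<in> F \<Longrightarrow> \<bar>representation B x b\<bar> \<le> M"
proof -
  define \<Phi> where "\<Phi> c = (\<Sum>b\<in>F. c b *\<^sub>R b)" for c :: "'a \<Rightarrow> real"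
  \<comment> \<open>The sup-norm sphere as a finite union of boxes: coordinate \<open>b\<close> is
    pinned to \<open>-1\<close> or \<open>1\<close>, the others range over \<open>{-1..1}\<close>.
    Each box is a product of compact sets.\<close>
  define S where "S = (\<Union>(b, s) \<in> F \<times> {-1, 1::real}. PiE F (\<lambda>b'. if b' = b then {s} else {-1..1}))"
  have "continuous_map (product_topology (\<lambda>_. euclideanreal) F) T \<Phi>"
    unfolding \<Phi>_def using F
    by (intro lcs_continuous_sum lcs_continuous_scaleR continuous_map_product_projection) simp_all
  moreover have "compactin (product_topology (\<lambda>_. euclideanreal) F) S"
    unfolding S_def using F
    by (intro compactin_Union) (auto simp: compactin_PiE)
  ultimately have "compactin T (\<Phi> ` S)"
    by (rule image_compactin[rotated])
  then have "closedin T (\<Phi> ` S)"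
    using lcs compactin_imp_closedin by (auto simp: locally_convex_space_def)
  then have W: "openin T (UNIV - \<Phi> ` S)"
    by (metis closedin_def lcs_topspace)
  have iF: "independent F" using B F independent_mono by blast
  have "0 \<notin> \<Phi> ` S"
  proof
    assume "0 \<in> \<Phi> ` S"
    then obtain c where c: "c \<in> S" "\<Phi> c = 0" by auto
    have "\<forall>b\<in>F. c b = 0"
      using iF c(2) F unfolding \<Phi>_def by (metis independentD subset_refl)
    moreover obtain b s where "b \<in> F" "s \<in> {-1,1}" "c \<in> PiE F (\<lambda>b'. if b' = b then {s} else {-1..1})"
      using c(1) unfolding S_def by auto
    ultimately show False
      by (auto dest!: PiE_mem[of _ _ _ b])
  qed
  \<comment> \<open>Continuity of scalar multiplication at \<open>(0, 0)\<close> yields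
    \<open>U\<close> and \<open>V\<close> such that no \<open>c *\<^sub>R x\<close> with
    \<open>c \<in> U\<close> and \<open>x \<in> V\<close> lies in the image of the sphere.\<close>
  moreover have "openin (prod_topology euclideanreal T) {z. (\<lambda>(c, x). c *\<^sub>R x) z \<in> UNIV - \<Phi> ` S}"
  proof -
    have "continuous_map (prod_topology euclideanreal T) T (\<lambda>(c, x). c *\<^sub>R x)"
      using lcs by (simp add: locally_convex_space_def)
    from openin_continuous_map_preimage[OF this W] show ?thesis by simp
  qed
  ultimately obtain U V where UV: "open U" "openin T V" "0 \<in> U" "0 \<in> V"
      "U \<times> V \<subseteq> {z. (\<lambda>(c, x). c *\<^sub>R x) z \<in> UNIV - \<Phi> ` S}"
    unfolding openin_prod_topology_alt
    by (auto dest!: spec[of _ "0::real"] spec[of _ "0::'a"])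
  obtain d where d: "d > 0" "ball 0 d \<subseteq> U"
    using UV open_contains_ball by metis
  have "\<bar>representation B x b\<bar> \<le> 1 / d" if x: "x \<in> V" "x \<in> span F" and b: "b \<in> F" for x b
  proof (rule ccontr)
    assume neg: "\<not> \<bar>representation B x b\<bar> \<le> 1 / d"
    let ?R = "\<lambda>b. \<bar>representation B x b\<bar>"
    \<comment> \<open>Dividing \<open>x\<close> by its sup norm \<open>m\<close> moves it into the
      image of the sphere, while \<open>m > 1 / d\<close> places the factor \<open>1 / m\<close> in
      \<open>U\<close>: a contradiction.\<close>
    define m where "m = Max (?R ` F)"
    have mge: "?R b' \<le> m" if "b' \<in> F" for b'
      using F that by (simp add: m_def)
    have "m \<in> ?R ` F" unfolding m_def using F b by (intro Max_in) auto
    then obtain k where k: "k \<in> F" "m = ?R k" by auto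
    have md: "m > 1 / d" using neg mge[OF b] by linarith
    then have m0: "m > 0" using d by (meson less_trans zero_less_divide_1_iff)
    define c where "c = restrict (\<lambda>b. representation B x b / m) F"
    have cb: "\<bar>c b'\<bar> \<le> 1" if "b' \<in> F" for b'
      using that mge[OF that] m0 by (simp add: c_def)
    have "\<bar>c k\<bar> = 1" using k m0 by (simp add: c_def)
    then have ck: "c k \<in> {-1,1}" by (auto simp: abs_if split: if_splits)
    have "c b' \<in> {-1..1}" if "b' \<in> F" for b'
      using cb[OF that] by (simp add: abs_le_iff)
    moreover have "c \<in> extensional F" by (simp add: c_def)
    ultimately have "c \<in> PiE F (\<lambda>b'. if b' = k then {c k} else {-1..1})"
      by (simp add: PiE_iff)
    then have "c \<in> S"
      unfolding S_def using k ck by (intro UN_I[of "(k, c k)"]) auto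
    moreover have "\<Phi> c = (1 / m) *\<^sub>R x"
    proof -
      have "\<Phi> c = (1 / m) *\<^sub>R (\<Sum>b\<in>F. representation B x b *\<^sub>R b)"
        unfolding \<Phi>_def scaleR_sum_right by (rule sum.cong) (auto simp: c_def)
      also have "(\<Sum>b\<in>F. representation B x b *\<^sub>R b) = x"
        using sum_representation_eq[OF iF x(2) F(1) order_refl] representation_extend[OF B x(2) F(2)]
        by simp
      finally show ?thesis .
    qed
    moreover have "1 / m \<in> U"
      using d m0 md by (intro subsetD[OF d(2)]) (simp add: field_simps)
    ultimately show False
      using UV(5) x(1) by (force simp: image_iff)
  qed
  then show thesis
    using that[of V "1 / d"] UV d by auto
qed

text \<open>By linearity the bound near 0 scales to continuity at 0, which translation carries to
  every point of \<open>span F\<close>.\<close>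

lemma continuous_map_coordinate:
  assumes B: "independent B" and F: "finite F" "F \<subseteq> B" and b: "b \<in> F"
  shows "continuous_map (subtopology T (span F)) euclideanreal (\<lambda>x. representation B x b)"
proof -
  obtain V M where V: "openin T V" "0 \<in> V" "M > 0"
    and M: "\<And>x. x \<in> V \<Longrightarrow> x \<in> span F \<Longrightarrow> \<bar>representation B x b\<bar> \<le> M"
    using coordinate_bounded_near_0[OF B F] b by metis
  have FB: "span F \<subseteq> span B" using F by (simp add: span_mono)
  show ?thesis
    unfolding continuous_map_def
  proof (intro conjI allI impI)
    fix U :: "real set" assume "openin euclideanreal U"
    then have U: "open U" by simp
    show "openin (subtopology T (span F)) {x \<in> topspace (subtopology T (span F)). representation B x b \<in> U}"
    proof (subst openin_subopen, intro ballI)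
      fix x assume "x \<in> {x \<in> topspace (subtopology T (span F)). representation B x b \<in> U}"
      then have x: "x \<in> span F" "representation B x b \<in> U" by auto
      obtain e where e: "e > 0" "ball (representation B x b) e \<subseteq> U"
        using U x open_contains_ball by metis
      \<comment> \<open>The factor \<open>2 * M / e\<close> turns the bound \<open>M\<close> into
        \<open>e / 2\<close>, strictly below \<open>e\<close>.\<close>
      define O' where "O' = {y. (2 * M / e) *\<^sub>R (y - x) \<in> V}"
      have "openin T O'" unfolding O'_def by (rule lcs_openin_affine_preimage[OF V(1)])
      then have "openin (subtopology T (span F)) (O' \<inter> span F)"
        by (auto simp: openin_subtopology)
      moreover have "x \<in> O' \<inter> span F" using x V by (simp add: O'_def)
      moreover have "representation B y b \<in> U" if y: "y \<in> O'" "y \<in> span F" for y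
      proof -
        have "\<bar>representation B ((2 * M / e) *\<^sub>R (y - x)) b\<bar> \<le> M"
        proof (rule M)
          show "(2 * M / e) *\<^sub>R (y - x) \<in> V" using y by (simp add: O'_def)
          show "(2 * M / e) *\<^sub>R (y - x) \<in> span F" using x y by (intro span_scale span_diff)
        qed
        moreover have "representation B ((2 * M / e) *\<^sub>R (y - x)) b
            = 2 * M / e * (representation B y b - representation B x b)"
        proof -
          have "x \<in> span B" "y \<in> span B" using x y FB by auto
          then show ?thesis
            using B by (simp add: representation_scale representation_diff span_diff)
        qed
        ultimately have "(2 * M / e) * \<bar>representation B y b - representation B x b\<bar> \<le> M"
          using V(3) e(1) by (simp add: abs_mult)
        then have "\<bar>representation B y b - representation B x b\<bar> \<le> e / 2"
          using V(3) e(1) by (simp add: field_simps)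
        then show ?thesis
          using e by (intro subsetD[OF e(2)]) (auto simp: dist_real_def abs_minus_commute)
      qed
      ultimately show "\<exists>W. openin (subtopology T (span F)) W \<and> x \<in> W \<and>
          W \<subseteq> {x \<in> topspace (subtopology T (span F)). representation B x b \<in> U}"
        by (intro exI[of _ "O' \<inter> span F"]) auto
    qed
  qed auto
qed

text \<open>On \<open>span F\<close> every support lies in \<open>F\<close>, so the sum has a fixed
  finite range of continuous summands.\<close>

lemma continuous_map_finsum_span:
  assumes B: "independent B" and F: "finite F" "F \<subseteq> B"
    and h: "\<And>b. continuous_on UNIV (h b)" "\<And>b. h b 0 = 0"
  shows "continuous_map (subtopology T (span F)) euclideanreal
    (\<lambda>x. finsum_on_support h (representation B x))"
proof (rule continuous_map_eq)
  show "continuous_map (subtopology T (span F)) euclideanreal (\<lambda>x. \<Sum>b\<in>F. h b (representation B x b))"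
  proof (rule continuous_map_sum[OF F(1)])
    fix b assume "b \<in> F"
    from continuous_map_compose[OF continuous_map_coordinate[OF B F this], of euclideanreal "h b"] h(1)
    show "continuous_map (subtopology T (span F)) euclideanreal (\<lambda>x. h b (representation B x b))"
      by (simp add: o_def)
  qed
  fix x assume "x \<in> topspace (subtopology T (span F))"
  then have "{b. representation B x b \<noteq> 0} \<subseteq> F"
    using representation_eq_0_outside[OF B F(2)] by auto
  then show "(\<Sum>b\<in>F. h b (representation B x b)) = finsum_on_support h (representation B x)"
    using F h by (subst finsum_on_support_superset) auto
qed

section \<open>\<open>k_R_space\<close> topologies whose compact sets are finite-dimensional\<close>

context
  fixes B :: "'a set"
  assumes B: "independent B" "span B = UNIV"
    and kR: "k_R_space T"
    and cpt: "\<And>K. compactin T K \<Longrightarrow> finite_dimensional_set K"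
begin

text \<open>The hypotheses \<open>kR\<close> and \<open>cpt\<close> enter only through this lemma:
  each compact set lies in the span of finitely many basis vectors, where the sum is
  continuous.\<close>

lemma k_R_continuous_finsum:
  assumes h: "\<And>b. continuous_on UNIV (h b)" "\<And>b. h b 0 = 0"
  shows "continuous_map T euclideanreal (\<lambda>x. finsum_on_support h (representation B x))"
proof -
  have "continuous_map (subtopology T K) euclideanreal (\<lambda>x. finsum_on_support h (representation B x))"
    if K: "compactin T K" for K
  proof -
    obtain G where G: "finite G" "K \<subseteq> span G"
      using cpt[OF K] unfolding finite_dimensional_set_def by blast
    define F where "F = (\<Union>g\<in>G. {b. representation B g b \<noteq> 0})"
    have F: "finite F" "F \<subseteq> B"
      using G representation_ne_zero by (auto simp: F_def finite_representation)
    have "G \<subseteq> span F"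
    proof
      fix g assume g: "g \<in> G"
      have "g = (\<Sum>b | representation B g b \<noteq> 0. representation B g b *\<^sub>R b)"
        using sum_nonzero_representation_eq[of B g] B by simp
      also have "\<dots> \<in> span F"
        using g by (intro span_sum span_scale span_base) (auto simp: F_def)
      finally show "g \<in> span F" .
    qed
    then have "K \<subseteq> span F"
      using G(2) span_minimal[OF _ subspace_span] by blast
    then show ?thesis
      by (rule continuous_map_from_subtopology_mono[OF continuous_map_finsum_span[OF B(1) F h]])
  qed
  then show ?thesis
    using kR unfolding k_R_space_def by blast
qed

text \<open>The function \<open>x \<mapsto> \<Sum>\<^sub>b sqrt \<bar>x\<^sub>b\<bar>\<close> is less than 1 on some convex neighbourhood of 0. If that
  neighbourhood contained \<open>b / N\<close> for \<open>N\<close> different basis vectors \<open>b\<close>, it would contain their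
  average, where the function takes the value 1.\<close>
lemma k_R_basis_countable: "countable B"
proof -
  define h where "h = (\<lambda>(_::'a) t. sqrt \<bar>t\<bar>)"
  let ?q = "\<lambda>x. finsum_on_support h (representation B x)"
  have "continuous_map T euclideanreal ?q"
    by (rule k_R_continuous_finsum) (auto simp: h_def intro!: continuous_intros)
  then have O: "openin T {x. ?q x \<in> {..<1}}"
    using openin_continuous_map_preimage[of T euclideanreal ?q "{..<1}"] by simp
  have "0 \<in> {x. ?q x \<in> {..<1}}"
    by (simp add: finsum_on_support_def representation_zero)
  then obtain V where V: "openin T V" "0 \<in> V" "convex V" "V \<subseteq> {x. ?q x \<in> {..<1}}"
    using lcs_convex_nbhd[OF O] by metis
  \<comment> \<open>\<open>Suc n\<close> is both the scaling divisor and the number of vectors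
    averaged below. As \<open>V\<close> absorbs every vector, the sets \<open>D n\<close> cover
    \<open>B\<close>.\<close>
  define D where "D n = {b\<in>B. (1 / real (Suc n)) *\<^sub>R b \<in> V}" for n
  have fin: "finite (D n)" for n
  proof (rule ccontr)
    assume "infinite (D n)"
    then obtain F where F: "F \<subseteq> D n" "finite F" "card F = Suc n"
      using infinite_arbitrarily_large by blast
    let ?N = "real (Suc n)"
    define x where "x = (\<Sum>b\<in>F. (1 / ?N) *\<^sub>R ((1 / ?N) *\<^sub>R b))"
    have "x \<in> V"
      unfolding x_def using F by (intro convex_sum[OF _ V(3)]) (auto simp: D_def)
    then have "?q x < 1" using V by auto
    \<comment> \<open>The \<open>Suc n\<close> nonzero coordinates of \<open>x\<close> are
      \<open>1 / (?N * ?N)\<close>, so their roots add up to 1.\<close>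
    have rx: "representation B x c = (if c \<in> F then 1 / (?N * ?N) else 0)" for c
    proof -
      have "representation B x c = (\<Sum>b\<in>F. representation B ((1 / ?N) *\<^sub>R ((1 / ?N) *\<^sub>R b)) c)"
        unfolding x_def using B by (subst representation_sum) auto
      also have "\<dots> = (\<Sum>b\<in>F. if c = b then 1 / (?N * ?N) else 0)"
        using F B
        by (intro sum.cong refl)
          (auto simp: representation_scale representation_basis D_def simp del: scaleR_scaleR)
      finally show ?thesis using F by (simp del: of_nat_Suc)
    qed
    have "?q x = (\<Sum>b\<in>F. sqrt \<bar>representation B x b\<bar>)"
      unfolding h_def using F by (subst finsum_on_support_superset[of F]) (auto simp: rx)
    also have "\<dots> = (\<Sum>b\<in>F. 1 / ?N)"
      by (intro sum.cong refl) (simp add: rx real_sqrt_divide del: of_nat_Suc)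
    also have "\<dots> = 1" using F by simp
    finally show False using \<open>?q x < 1\<close> by simp
  qed
  have "B \<subseteq> (\<Union>n. D n)"
  proof
    fix b assume b: "b \<in> B"
    obtain d where d: "d > 0" "\<And>c. \<bar>c\<bar> < d \<Longrightarrow> c *\<^sub>R b \<in> V"
      using lcs_absorbs[OF V(1,2)] by metis
    obtain n where "1 / real (Suc n) < d"
      using d(1) nat_approx_posE by blast
    then have "b \<in> D n" using b d(2) by (simp add: D_def)
    then show "b \<in> (\<Union>n. D n)" by blast
  qed
  then show ?thesis
    using fin by (meson countable_UN countable_finite countable_subset countableI_type)
qed

text \<open>The isomorphism is the coordinate map along an enumeration of the basis. It is
  continuous because weighted balls have open preimages, and open because symmetric convex
  neighbourhoods of 0 have absolutely convex absorbing images.\<close>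

lemma k_R_top_iso_phi:
  assumes inf: "\<not> finite_dimensional_set (UNIV :: 'a set)"
  shows "top_iso_phi T"
proof -
  have "infinite B"
    using inf B(2) unfolding finite_dimensional_set_def by blast
  with k_R_basis_countable obtain e :: "nat \<Rightarrow> 'a" where e: "bij_betw e UNIV B"
    using bij_betw_from_nat_into by blast
  have eB: "e n \<in> B" for n using e by (auto simp: bij_betw_def)
  have ee: "e m = e n \<longleftrightarrow> m = n" for m n using e by (auto simp: bij_betw_def inj_eq)
  define f where "f x n = representation B x (e n)" for x n
  have add: "f (x + y) = (\<lambda>n. f x n + f y n)" for x y
    using B by (simp add: f_def fun_eq_iff representation_add)
  have scale: "f (c *\<^sub>R x) = (\<lambda>n. c * f x n)" for c x
    using B by (simp add: f_def fun_eq_iff representation_scale)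
  have supp: "{b. representation B x b \<noteq> 0} = e ` {n. f x n \<noteq> 0}" for x
    using e representation_ne_zero[of B x] by (force simp: f_def bij_betw_def)
  have fphi: "f x \<in> phi_set" for x
    using finite_imageD[of e "{n. f x n \<noteq> 0}"] finite_representation[of B x] e
    by (auto simp: phi_set_iff supp[symmetric] bij_betw_def intro: inj_on_subset)
  have "inj f"
  proof
    fix x y assume "f x = f y"
    then have "representation B x b = representation B y b" if "b \<in> B" for b
      using e that by (metis f_def bij_betw_imp_surj_on imageE)
    then have "representation B x b = representation B y b" for b
      using representation_ne_zero[of B x b] representation_ne_zero[of B y b] by metis
    then have "representation B x = representation B y" by (rule ext)
    then show "x = y"
      using sum_nonzero_representation_eq[OF B(1)] B(2) by (metis UNIV_I)
  qed
  moreover have surj: "y \<in> range f" if y: "y \<in> phi_set" for y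
  proof -
    let ?N = "{n. y n \<noteq> 0}"
    have N: "finite ?N" using y by (simp add: phi_set_iff)
    have "f (\<Sum>n\<in>?N. y n *\<^sub>R e n) m = (\<Sum>n\<in>?N. if m = n then y n else 0)" for m
      using B by (simp add: f_def representation_sum representation_scale representation_basis eB ee
          if_distrib cong: if_cong)
    also have "(\<Sum>n\<in>?N. if m = n then y n else 0) = y m" for m using N by simp
    finally have "f (\<Sum>n\<in>?N. y n *\<^sub>R e n) = y" by (rule ext)
    then show ?thesis by (metis rangeI)
  qed
  ultimately have bij: "bij_betw f UNIV phi_set"
    using fphi by (auto simp: bij_betw_def)
  have ball: "openin T {x. weighted_l1 w (f x) < 1}" for w :: "nat \<Rightarrow> real"
  proof -
    define h where "h b t = w (inv e b) * \<bar>t\<bar>" for b t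
    have "inv e (e n) = n" for n using e by (simp add: bij_betw_def)
    then have "finsum_on_support h (representation B x) = weighted_l1 w (f x)" for x
      unfolding finsum_on_support_def supp using e
      by (subst sum.reindex) (auto simp: bij_betw_def h_def f_def intro: inj_on_subset)
    moreover have "continuous_map T euclideanreal (\<lambda>x. finsum_on_support h (representation B x))"
      by (rule k_R_continuous_finsum) (auto simp: h_def intro!: continuous_intros)
    ultimately have "continuous_map T euclideanreal (\<lambda>x. weighted_l1 w (f x))"
      by simp
    from openin_continuous_map_preimage[OF this, of "{..<1}"] show ?thesis by simp
  qed
  have "continuous_map T phi_topology f"
    unfolding continuous_map_def topspace_phi_topology
  proof (intro conjI allI impI)
    fix U assume U: "openin phi_topology U"
    show "openin T {x \<in> topspace T. f x \<in> U}"
    proof (subst openin_subopen, intro ballI)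
      fix x assume "x \<in> {x \<in> topspace T. f x \<in> U}"
      then have "f x \<in> U" by simp
      then obtain A where A: "phi_abs_convex A" "phi_absorbing A" "\<forall>a\<in>A. (\<lambda>n. f x n + a n) \<in> U"
        using U[unfolded openin_phi_topology] by (elim conjE) (drule (1) bspec, blast)
      obtain w where w: "{x\<in>phi_set. weighted_l1 w x < 1} \<subseteq> A"
        by (rule weighted_l1_ball_subset_phi_nbhd[OF A(1,2)])
      let ?O = "{y. y - x \<in> {x. weighted_l1 w (f x) < 1}}"
      have "openin T ?O" using ball by (rule lcs_openin_translation)
      moreover have "x \<in> ?O"
        using scale[of 0 0] by (simp add: finsum_on_support_def)
      moreover have "f y \<in> U" if "y \<in> ?O" for y
      proof -
        have "f (y - x) \<in> A" using that w fphi by auto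
        from bspec[OF A(3) this] show ?thesis using add[of x "y - x"] by simp
      qed
      ultimately show "\<exists>W. openin T W \<and> x \<in> W \<and> W \<subseteq> {x \<in> topspace T. f x \<in> U}"
        by (intro exI[of _ ?O]) auto
    qed
  qed (use fphi in auto)
  moreover have "open_map T phi_topology f"
    unfolding open_map_def openin_phi_topology
  proof (intro allI impI conjI ballI)
    fix U y assume U: "openin T U" and "y \<in> f ` U"
    then obtain x where x: "x \<in> U" "y = f x" by blast
    \<comment> \<open>\<open>v - (- x)\<close> is \<open>v + x\<close> in the form of the
      translation lemma; the set is \<open>U\<close> moved to the origin.\<close>
    have O: "openin T {v. v - (- x) \<in> U}" using U by (rule lcs_openin_translation)
    have "0 \<in> {v. v - (- x) \<in> U}" using x by simp
    then obtain V where V: "openin T V" "0 \<in> V" "convex V" "V \<subseteq> {v. v - (- x) \<in> U}"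
      using lcs_convex_nbhd[OF O] by metis
    \<comment> \<open>Intersecting with the reflection makes the convex neighbourhood symmetric,
      hence absolutely convex.\<close>
    define W where "W = V \<inter> {v. - v \<in> V}"
    have oW: "openin T W" "0 \<in> W"
      using V lcs_openin_affine_preimage[of V "-1" 0] by (auto simp: W_def)
    have cW: "convex W"
      unfolding W_def
    proof (rule convex_Int[OF V(3)])
      show "convex {v. - v \<in> V}"
        using V(3) unfolding convex_def by (auto simp: minus_add_distrib simp flip: scaleR_minus_right)
    qed
    have acW: "a *\<^sub>R v + b *\<^sub>R u \<in> W" if vu: "v \<in> W" "u \<in> W" and ab: "\<bar>a\<bar> + \<bar>b\<bar> \<le> 1" for a b v u
    proof -
      \<comment> \<open>Signs move into the vectors, leaving nonnegative coefficients. Normalising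
        by their sum \<open>s\<close> gives a convex combination, which is then contracted towards 0
        by the factor \<open>s\<close>.\<close>
      define v' u' where "v' = (if a \<ge> 0 then v else - v)" and "u' = (if b \<ge> 0 then u else - u)"
      have "v' \<in> W" "u' \<in> W" using vu by (auto simp: W_def v'_def u'_def)
      have "\<bar>a\<bar> *\<^sub>R v' + \<bar>b\<bar> *\<^sub>R u' \<in> W"
      proof (cases "\<bar>a\<bar> + \<bar>b\<bar> = 0")
        case True
        then have "a = 0" "b = 0" by auto
        then show ?thesis using oW(2) by simp
      next
        case False
        define s where "s = \<bar>a\<bar> + \<bar>b\<bar>"
        have s: "0 < s" "s \<le> 1" using False ab by (auto simp: s_def)
        have "(\<bar>a\<bar> / s) *\<^sub>R v' + (\<bar>b\<bar> / s) *\<^sub>R u' \<in> W"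
          using \<open>v' \<in> W\<close> \<open>u' \<in> W\<close> s
          by (intro convexD[OF cW]) (auto simp: s_def simp flip: add_divide_distrib)
        then have "s *\<^sub>R ((\<bar>a\<bar> / s) *\<^sub>R v' + (\<bar>b\<bar> / s) *\<^sub>R u') + (1 - s) *\<^sub>R 0 \<in> W"
          by (rule convexD[OF cW]) (use oW(2) s in auto)
        then show ?thesis using s by (simp add: scaleR_add_right)
      qed
      then show ?thesis by (auto simp: v'_def u'_def split: if_splits)
    qed
    have "phi_abs_convex (f ` W)"
      unfolding phi_abs_convex_def
    proof (intro conjI ballI allI impI)
      fix y z and a b :: real assume "y \<in> f ` W" "z \<in> f ` W" "\<bar>a\<bar> + \<bar>b\<bar> \<le> 1"
      then obtain v u where vu: "y = f v" "z = f u" "a *\<^sub>R v + b *\<^sub>R u \<in> W"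
        using acW by blast
      have "(\<lambda>n. a * y n + b * z n) = f (a *\<^sub>R v + b *\<^sub>R u)"
        using vu by (simp add: add scale)
      then show "(\<lambda>n. a * y n + b * z n) \<in> f ` W"
        using vu(3) by (rule image_eqI)
    qed (use fphi in auto)
    moreover have "phi_absorbing (f ` W)"
      unfolding phi_absorbing_def
    proof
      fix z assume "z \<in> phi_set"
      then obtain v where v: "z = f v" using surj by blast
      obtain d where d: "d > 0" "\<And>c. \<bar>c\<bar> < d \<Longrightarrow> c *\<^sub>R v \<in> W"
        using lcs_absorbs[OF oW, of v] by metis
      \<comment> \<open>Halving \<open>d\<close> passes from the strict bound on scalars to the
        closed one in \<open>phi_absorbing\<close>.\<close>
      have "(\<lambda>n. s * z n) \<in> f ` W" if "\<bar>s\<bar> \<le> d / 2" for s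
      proof (rule image_eqI)
        show "(\<lambda>n. s * z n) = f (s *\<^sub>R v)" by (simp add: scale v)
        show "s *\<^sub>R v \<in> W" using d that by simp
      qed
      then show "\<exists>t>0. \<forall>s. \<bar>s\<bar> \<le> t \<longrightarrow> (\<lambda>n. s * z n) \<in> f ` W"
        using d(1) by (intro exI[of _ "d / 2"]) auto
    qed
    moreover have "(\<lambda>n. y n + a n) \<in> f ` U" if a: "a \<in> f ` W" for a
    proof -
      obtain v where v: "v \<in> W" "a = f v" using a by blast
      then have "x + v \<in> U" using V(4) by (auto simp: W_def add.commute)
      moreover have "(\<lambda>n. y n + a n) = f (x + v)" using v x by (simp add: add)
      ultimately show ?thesis by (simp add: image_eqI)
    qed
    ultimately show "\<exists>A. phi_abs_convex A \<and> phi_absorbing A \<and> (\<forall>a\<in>A. (\<lambda>n. y n + a n) \<in> f ` U)"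
      by blast
  qed (use fphi in auto)
  ultimately have "homeomorphic_map T phi_topology f"
    using bij by (intro bijective_open_imp_homeomorphic_map) (auto simp: bij_betw_def topspace_phi_topology)
  then show ?thesis
    unfolding top_iso_phi_def using add scale bij by blast
qed

end

end

section \<open>Dimension, compact sets and the \<open>k_R_space\<close> property of copies of
  \<open>phi_set\<close>\<close>

context
  fixes T :: "'a::real_vector topology" and f :: "'a \<Rightarrow> nat \<Rightarrow> real" and e :: "nat \<Rightarrow> 'a"
  assumes lcs: "locally_convex_space T"
    and lin: "\<And>n. linear (\<lambda>x. f x n)"
    and inj: "inj f" and phi: "\<And>x. f x \<in> phi_set"
    and e: "\<And>n m. f (e n) m = (if m = n then 1 else 0)"
    and ball: "\<And>w. (\<And>n. 0 < w n) \<Longrightarrow> openin T {x. weighted_l1 w (f x) < 1}"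
begin

text \<open>Both sides have the same image under the injective \<open>f\<close>, as
  \<open>f (e n)\<close> is the \<open>n\<close>-th unit vector.\<close>

lemma phi_coordinates_expansion:
  assumes "finite N" "{n. f x n \<noteq> 0} \<subseteq> N"
  shows "x = (\<Sum>n\<in>N. f x n *\<^sub>R e n)"
proof -
  have "f (\<Sum>n\<in>N. f x n *\<^sub>R e n) m = f x m" for m
  proof -
    have "f (\<Sum>n\<in>N. f x n *\<^sub>R e n) m = (\<Sum>n\<in>N. f x n * f (e n) m)"
      using linear_sum[OF lin, of "\<lambda>n. f x n *\<^sub>R e n" N m] linear_cmul[OF lin] by simp
    also have "\<dots> = (\<Sum>n\<in>N. if m = n then f x n else 0)"
      by (intro sum.cong) (auto simp: e)
    finally show ?thesis using assms by auto
  qed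
  then show ?thesis using inj by (metis ext injD)
qed

text \<open>Finitely many vectors involve finitely many coordinates; any other coordinate
  \<open>m\<close> vanishes on their span, yet not at \<open>e m\<close>.\<close>

lemma phi_infinite_dimensional: "\<not> finite_dimensional_set (UNIV :: 'a set)"
proof
  assume "finite_dimensional_set (UNIV :: 'a set)"
  then obtain G :: "'a set" where G: "finite G" "UNIV \<subseteq> span G"
    unfolding finite_dimensional_set_def by blast
  define N where "N = (\<Union>g\<in>G. {n. f g n \<noteq> 0})"
  have "finite N" using G phi by (auto simp: N_def phi_set_iff)
  then obtain m where m: "m \<notin> N" using ex_new_if_finite infinite_UNIV_nat by blast
  have "subspace {x. f x m = 0}"
    using lin by (rule linear_subspace_kernel)
  moreover have "G \<subseteq> {x. f x m = 0}" using m by (auto simp: N_def)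
  ultimately have "span G \<subseteq> {x. f x m = 0}" by (rule span_minimal[rotated])
  then have "e m \<in> {x. f x m = 0}" using G(2) by blast
  then show False using e[of m m] by simp
qed

lemma phi_openin_ball:
  assumes "\<And>n. 0 < w n" "r > 0"
  shows "openin T {x. weighted_l1 w (f x) < r}"
proof -
  have "weighted_l1 (\<lambda>n. w n / r) y = weighted_l1 w y / r" for y :: "nat \<Rightarrow> real"
    by (simp add: finsum_on_support_def sum_divide_distrib)
  then show ?thesis
    using ball[of "\<lambda>n. w n / r"] assms by simp
qed

text \<open>If infinitely many coordinates occur on \<open>K\<close>, weights can be chosen large enough that the weighted
  \<open>l\<^sup>1\<close> norm is unbounded on \<open>K\<close>.\<close>
lemma phi_compact_finite_dimensional:
  assumes K: "compactin T K"
  shows "finite_dimensional_set K"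
proof -
  define N where "N = (\<Union>x\<in>K. {n. f x n \<noteq> 0})"
  have "\<forall>n. \<exists>x. n \<in> N \<longrightarrow> x \<in> K \<and> f x n \<noteq> 0" by (auto simp: N_def)
  then obtain X where X: "\<And>n. n \<in> N \<Longrightarrow> X n \<in> K" "\<And>n. n \<in> N \<Longrightarrow> f (X n) n \<noteq> 0" by metis
  \<comment> \<open>The weight gives the witness \<open>X n\<close> norm at least
    \<open>n + 1\<close>; the value 1 off \<open>N\<close> keeps all weights positive.\<close>
  define w where "w n = (if n \<in> N then (real n + 1) / \<bar>f (X n) n\<bar> else 1)" for n
  have w: "w n > 0" for n using X by (simp add: w_def)
  have "K \<subseteq> \<Union>((\<lambda>k. {x. weighted_l1 w (f x) < real (Suc k)}) ` UNIV)"
  proof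
    fix x
    obtain k where "weighted_l1 w (f x) < real k" using reals_Archimedean2 by blast
    then have "weighted_l1 w (f x) < real (Suc k)" by simp
    then show "x \<in> \<Union>((\<lambda>k. {x. weighted_l1 w (f x) < real (Suc k)}) ` UNIV)" by blast
  qed
  moreover have "openin T {x. weighted_l1 w (f x) < real (Suc k)}" for k
    using w by (rule phi_openin_ball) simp
  then have "\<And>U. U \<in> (\<lambda>k. {x. weighted_l1 w (f x) < real (Suc k)}) ` UNIV \<Longrightarrow> openin T U"
    by blast
  ultimately obtain \<F> where \<F>: "finite \<F>"
      "\<F> \<subseteq> (\<lambda>k. {x. weighted_l1 w (f x) < real (Suc k)}) ` UNIV" "K \<subseteq> \<Union>\<F>"
    using compactinD[OF K] by metis
  then obtain I where I: "finite I" "K \<subseteq> (\<Union>k\<in>I. {x. weighted_l1 w (f x) < real (Suc k)})"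
    by (metis finite_subset_image)
  \<comment> \<open>A ball of the finite subcover contains \<open>X n\<close>, and its radius
    \<open>Suc k\<close> must exceed \<open>n + 1\<close>.\<close>
  have "N \<subseteq> {..Max I}"
  proof
    fix n assume n: "n \<in> N"
    then obtain k where k: "k \<in> I" "weighted_l1 w (f (X n)) < real (Suc k)"
      using I X by blast
    have "real n + 1 = w n * \<bar>f (X n) n\<bar>" using n X by (simp add: w_def)
    also have "\<dots> \<le> weighted_l1 w (f (X n))"
      using phi[of "X n"] w by (intro weighted_l1_ge_term) (auto simp: phi_set_iff less_imp_le)
    also have "\<dots> < real (Suc k)" by (rule k)
    finally have "n \<le> k" by simp
    also have "k \<le> Max I" using I k by simp
    finally show "n \<in> {..Max I}" by simp
  qed
  then have N: "finite N" using finite_subset by blast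
  have "K \<subseteq> span (e ` N)"
  proof
    fix x assume "x \<in> K"
    then have "x = (\<Sum>n\<in>N. f x n *\<^sub>R e n)"
      using N by (intro phi_coordinates_expansion) (auto simp: N_def)
    also have "\<dots> \<in> span (e ` N)" by (intro span_sum span_scale span_base imageI)
    finally show "x \<in> span (e ` N)" .
  qed
  then show ?thesis
    unfolding finite_dimensional_set_def using N by blast
qed

text \<open>The pairs \<open>(y, t)\<close> with \<open>g (y + t *\<^sub>R v) \<in> U\<close>
  include \<open>C \<times> {0}\<close>; since \<open>C\<close> is compact, the tube lemma provides
  an interval of \<open>t\<close> that is uniform in \<open>y\<close>.\<close>

lemma k_R_thicken_compact:
  assumes g: "\<And>K. compactin T K \<Longrightarrow> continuous_map (subtopology T K) euclideanreal g"
    and C: "compactin T C" "g ` C \<subseteq> U" and U: "open U"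
  obtains d where "d > 0"
    "compactin T ((\<lambda>(y, t). y + t *\<^sub>R v) ` (C \<times> {-d..d}))"
    "g ` (\<lambda>(y, t). y + t *\<^sub>R v) ` (C \<times> {-d..d}) \<subseteq> U"
proof -
  let ?s = "\<lambda>(y, t). y + t *\<^sub>R v"
  have s: "continuous_map (prod_topology T euclideanreal) T ?s"
  proof -
    have "continuous_map (prod_topology T euclideanreal) T (\<lambda>z. fst z + snd z *\<^sub>R v)"
      by (intro lcs_continuous_add[OF lcs] lcs_continuous_scaleR[OF lcs] continuous_map_fst continuous_map_snd)
        (simp add: lcs_topspace[OF lcs])
    then show ?thesis by (simp add: case_prod_unfold)
  qed
  have cpt: "compactin T (?s ` (C \<times> {-d..d}))" for d
    by (rule image_compactin[OF _ s]) (use C in \<open>auto simp: compactin_Times\<close>)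
  \<comment> \<open>Confining \<open>t\<close> to \<open>{-1..1}\<close> first makes the image
    compact, so that \<open>g\<close> is continuous on it.\<close>
  let ?P = "prod_topology (subtopology T C) (subtopology euclideanreal {-1..1})"
  have P: "?P = subtopology (prod_topology T euclideanreal) (C \<times> {-1..1})"
    by (simp add: subtopology_Times)
  have "continuous_map ?P (subtopology T (?s ` (C \<times> {-1..1}))) ?s"
    unfolding P using continuous_map_from_subtopology[OF s]
    by (intro continuous_map_into_subtopology) auto
  from continuous_map_compose[OF this g[OF cpt]]
  have W: "openin ?P {z \<in> topspace ?P. (g \<circ> ?s) z \<in> U}"
    by (rule openin_continuous_map_preimage) (use U in simp)
  have CW: "C \<times> {0} \<subseteq> {z \<in> topspace ?P. (g \<circ> ?s) z \<in> U}"
    using C by (auto simp: lcs_topspace[OF lcs])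
  have "compactin (subtopology T C) C" "0 \<in> topspace (subtopology euclideanreal {-1..1::real})"
    using C by (auto simp: compactin_subtopology)
  from tube_lemma_left[OF W this CW] obtain O1 O2 where O:
      "openin (subtopology euclideanreal {-1..1::real}) O2" "C \<subseteq> O1" "0 \<in> O2"
      "O1 \<times> O2 \<subseteq> {z \<in> topspace ?P. (g \<circ> ?s) z \<in> U}"
    by blast
  obtain O3 where O3: "open O3" "O2 = O3 \<inter> {-1..1}"
    using O(1) by (auto simp: openin_subtopology)
  obtain r where r: "r > 0" "ball 0 r \<subseteq> O3"
    using O3 O(3) open_contains_ball by (metis IntD1)
  \<comment> \<open>Halving puts the closed interval inside the open ball; the bound 1 keeps it
    within \<open>{-1..1}\<close>.\<close>
  define d where "d = min (r / 2) 1"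
  have d: "d > 0" using r by (simp add: d_def)
  have "{-d..d} \<subseteq> O2"
  proof
    fix t assume "t \<in> {-d..d}"
    then have "\<bar>t\<bar> < r" "t \<in> {-1..1}" using r by (auto simp: d_def)
    then show "t \<in> O2" using r O3 by (auto simp: subset_iff dist_real_def)
  qed
  then have "C \<times> {-d..d} \<subseteq> {z \<in> topspace ?P. (g \<circ> ?s) z \<in> U}"
    using O by blast
  then have "g ` ?s ` (C \<times> {-d..d}) \<subseteq> U"
    by (force simp: image_subset_iff)
  then show thesis using that[OF d cpt] by blast
qed

text \<open>Thickening \<open>{x}\<close> successively in the directions \<open>e 0, e 1, \<dots>\<close> inside the preimage of \<open>U\<close>
  yields widths \<open>d n\<close>; the ball for the weights \<open>1 / d n\<close> around \<open>x\<close> lies in the union of the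
  resulting boxes.\<close>
lemma phi_k_R_space: "k_R_space T"
  unfolding k_R_space_def
proof (intro allI impI)
  fix g :: "'a \<Rightarrow> real"
  assume "\<forall>K. compactin T K \<longrightarrow> continuous_map (subtopology T K) euclideanreal g"
  then have g: "\<And>K. compactin T K \<Longrightarrow> continuous_map (subtopology T K) euclideanreal g"
    by blast
  have "openin T {x \<in> topspace T. g x \<in> U}" if "openin euclideanreal U" for U
  proof (subst openin_subopen, intro ballI)
    have U: "open U" using that by simp
    fix x assume "x \<in> {x \<in> topspace T. g x \<in> U}"
    then have x: "g x \<in> U" by simp
    define S where "S n d C = (\<lambda>(y, t). y + t *\<^sub>R e n) ` (C \<times> {-d..d})" for n d C
    \<comment> \<open>The clause for \<open>n = 0\<close> fixes the start of the chain; the widths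
      \<open>d\<close> are existential here and chosen afterwards.\<close>
    have "\<exists>C. \<forall>n. (compactin T (C n) \<and> g ` C n \<subseteq> U \<and> (n = 0 \<longrightarrow> C n = {x})) \<and>
        (\<exists>d>0. C (Suc n) = S n d (C n))"
    proof (rule dependent_nat_choice)
      show "\<exists>C. compactin T C \<and> g ` C \<subseteq> U \<and> ((0::nat) = 0 \<longrightarrow> C = {x})"
        using x by (intro exI[of _ "{x}"]) (simp add: lcs_topspace[OF lcs])
    next
      fix C and n :: nat assume "compactin T C \<and> g ` C \<subseteq> U \<and> (n = 0 \<longrightarrow> C = {x})"
      then obtain d where "d > 0" "compactin T (S n d C)" "g ` (S n d C) \<subseteq> U"
        unfolding S_def using k_R_thicken_compact[OF g _ _ U, of C "e n"] by metis
      then show "\<exists>C'. (compactin T C' \<and> g ` C' \<subseteq> U \<and> (Suc n = 0 \<longrightarrow> C' = {x})) \<and> (\<exists>d>0. C' = S n d C)"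
        by blast
    qed
    then obtain C where C': "\<And>n. (compactin T (C n) \<and> g ` C n \<subseteq> U \<and> (n = 0 \<longrightarrow> C n = {x})) \<and>
        (\<exists>d>0. C (Suc n) = S n d (C n))"
      by metis
    have C: "g ` C n \<subseteq> U" "C 0 = {x}" for n
      using C'[of n] C'[of 0] by simp_all
    from C' have "\<forall>n. \<exists>d>0. C (Suc n) = S n d (C n)" by simp
    from choice[OF this] obtain d where d: "\<And>n. d n > 0" "\<And>n. C (Suc n) = S n (d n) (C n)"
      by auto
    define w where "w n = 1 / d n" for n
    have w: "w n > 0" for n using d by (simp add: w_def)
    let ?O = "{y. y - x \<in> {z. weighted_l1 w (f z) < 1}}"
    have "openin T ?O" by (rule lcs_openin_translation[OF lcs ball[OF w]])
    moreover have "x \<in> ?O"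
      using linear_0[OF lin] by (simp add: finsum_on_support_def)
    moreover have "g y \<in> U" if y: "y \<in> ?O" for y
    proof -
      let ?z = "y - x"
      have fin: "finite {n. f ?z n \<noteq> 0}" using phi[of ?z] by (simp add: phi_set_iff)
      have bound: "\<bar>f ?z n\<bar> \<le> d n" for n
      proof -
        have "w n * \<bar>f ?z n\<bar> \<le> weighted_l1 w (f ?z)"
          using fin w by (intro weighted_l1_ge_term) (auto simp: less_imp_le)
        then have "\<bar>f ?z n\<bar> / d n \<le> 1" using y by (simp add: w_def)
        then show ?thesis using d(1)[of n] by simp
      qed
      \<comment> \<open>Each stage adds one direction to the partial sum. As \<open>y - x\<close>
        has finite support, some partial sum is all of it, whence
        \<open>y \<in> C k\<close>.\<close>
      have mem: "x + (\<Sum>n<k. f ?z n *\<^sub>R e n) \<in> C k" for k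
      proof (induction k)
        case 0
        then show ?case using C by simp
      next
        case (Suc k)
        have "(x + (\<Sum>n<k. f ?z n *\<^sub>R e n), f ?z k) \<in> C k \<times> {- d k..d k}"
          using Suc bound[of k] by (auto simp: abs_le_iff)
        then show ?case
          unfolding d(2) S_def by (rule rev_image_eqI) (simp add: add.assoc)
      qed
      obtain k where "{n. f ?z n \<noteq> 0} \<subseteq> {..<k}"
        using finite_nat_iff_bounded fin by blast
      then have "?z = (\<Sum>n<k. f ?z n *\<^sub>R e n)"
        by (intro phi_coordinates_expansion) auto
      then have "y \<in> C k" using mem[of k] by (metis add.commute diff_add_cancel)
      then show ?thesis using C(1) by blast
    qed
    ultimately show "\<exists>W. openin T W \<and> x \<in> W \<and> W \<subseteq> {x \<in> topspace T. g x \<in> U}"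
      by (intro exI[of _ ?O]) (auto simp: lcs_topspace[OF lcs])
  qed
  then show "continuous_map T euclideanreal g"
    by (simp add: continuous_map_def)
qed

end

theorem theorem3p7:
  fixes T :: "'a::real_vector topology"
  assumes "locally_convex_space T"
  shows "top_iso_phi T \<longleftrightarrow>
           (\<not> finite_dimensional_set (UNIV :: 'a set) \<and> k_R_space T \<and>
            \<not> (\<exists>K. compactin T K \<and> \<not> finite_dimensional_set K))"
proof
  assume "top_iso_phi T"
  then obtain f :: "'a \<Rightarrow> nat \<Rightarrow> real" where
    add: "\<And>x y. f (x + y) = (\<lambda>n. f x n + f y n)" and
    scale: "\<And>c x. f (c *\<^sub>R x) = (\<lambda>n. c * f x n)" and
    bij: "bij_betw f UNIV phi_set" and hom: "homeomorphic_map T phi_topology f"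
    unfolding top_iso_phi_def by blast
  have lin: "linear (\<lambda>x. f x n)" for n
    by (rule linearI) (simp_all add: add scale)
  have inj: "inj f" and phi: "f x \<in> phi_set" for x
    using bij by (auto simp: bij_betw_def)
  define e where "e n = inv f (\<lambda>m. if m = n then 1 else 0)" for n
  have "(\<lambda>m. if m = n then 1 else 0) \<in> range f" for n
    using bij by (simp add: bij_betw_def phi_set_iff)
  then have e: "f (e n) m = (if m = n then 1 else 0)" for n m
    by (simp add: e_def f_inv_into_f)
  have ball: "openin T {x. weighted_l1 w (f x) < 1}" if "\<And>n. 0 < w n" for w
    using openin_continuous_map_preimage[OF homeomorphic_imp_continuous_map[OF hom]
        openin_phi_weighted_l1_ball[OF that]] phi
    by (simp add: lcs_topspace[OF assms])
  \<comment> \<open>The isomorphism enters as a linear injection into \<open>phi_set\<close> that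
    reaches the unit vectors and pulls weighted balls back to open sets.\<close>
  note facts = assms lin inj phi e ball
  show "\<not> finite_dimensional_set (UNIV :: 'a set) \<and> k_R_space T \<and>
      \<not> (\<exists>K. compactin T K \<and> \<not> finite_dimensional_set K)"
    using phi_infinite_dimensional[OF facts] phi_k_R_space[OF facts]
      phi_compact_finite_dimensional[OF facts] by blast
next
  assume rhs: "\<not> finite_dimensional_set (UNIV :: 'a set) \<and> k_R_space T \<and>
      \<not> (\<exists>K. compactin T K \<and> \<not> finite_dimensional_set K)"
  obtain B :: "'a set" where B: "independent B" "span B = UNIV"
    using maximal_independent_subset[of UNIV] by (metis UNIV_eq_I top.extremum_unique)
  show "top_iso_phi T"
    by (rule k_R_top_iso_phi[OF assms B]) (use rhs in blast)+
qed

end
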